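(* Let $n,k,r,q\in\mathbb{N}$ with $n\geq k\geq r\geq q\geq 1$ and $n\equiv k \pmod 2$. If $n\geq k+2$, then $$\mu(n,k,r,q)>\mu(n,k+2,r,q).$$
   Context: $\mathbb{N}=\{0,1,2,\ldots\}$, $[n]=\{1,\ldots,n\}$, $[0]=\emptyset$. A 1-2-equivalence is an equivalence relation all of whose classes have size at most $2$. A PB-pair on a set $T$ is a pair $(\varepsilon,X)$ where $\varepsilon$ is a 1-2-equivalence on $T$ and $X\subseteq T$ is such that each element of $X$ belongs to a singleton $\varepsilon$-class. The join of PB-pairs $(\varepsilon_1,X_1)$ and $(\varepsilon_2,X_2)$ on $T$ is $(\varepsilon_1,X_1)\vee(\varepsilon_2,X_2)=(\varepsilon_1\vee\varepsilon_2,Z)$, where $Z=\{(x,y)\in X_1\times X_2: x \text{ and } y \text{ belong to the same class of } \varepsilon_1\vee\varepsilon_2\}$ and $\varepsilon_1\vee\varepsilon_2$ is the join in the lattice of equivalences; its rank is $|Z|$. For $m\in\mathbb{N}$ and $0\le k\le m$ with $k\equiv m\pmod 2$, $\varepsilon_{m,k}$ is the equivalence on $[m]$ with classes $\{1\},\ldots,\{k\},\{k+1,k+2\},\ldots,\{m-1,m\}$. For $m,k,t,q\in\mathbb{N}$, $\mu(m,k,t,q)$ is the number of PB-pairs $(\eta,X)$ on $[m]$ such that $|X|=q$ and $\operatorname{rank}((\varepsilon_{m,k},[t])\vee(\eta,X))=q$; if $\varepsilon_{m,k}$ is undefined or $(\varepsilon_{m,k},[t])$ is not a PB-pair on $[m]$,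 then $\mu(m,k,t,q)=0$. *)

theory Defs
  imports Main
begin

(* Infinite sets have card 0, hence the explicit finiteness requirement on classes. *)
definition one_two_equiv :: "'a set \<Rightarrow> ('a \<times> 'a) set \<Rightarrow> bool" where
  "one_two_equiv T \<epsilon> \<longleftrightarrow> equiv T \<epsilon> \<and> (\<forall>C \<in> T // \<epsilon>. finite C \<and> card C \<le> 2)"

definition pb_pair :: "'a set \<Rightarrow> ('a \<times> 'a) set \<times> 'a set \<Rightarrow> bool" where
  "pb_pair T = (\<lambda>(\<epsilon>, X). one_two_equiv T \<epsilon> \<and> X \<subseteq> T \<and> (\<forall>x \<in> X. {x} \<in> T // \<epsilon>))"

(* The lattice is that of equivalences on T under inclusion, so the join is the least
   equivalence on T containing both arguments. *)
definition equiv_join :: "'a set \<Rightarrow> ('a \<times> 'a) set \<Rightarrow> ('a \<times> 'a) set \<Rightarrow> ('a \<times> 'a) set" where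
  "equiv_join T \<epsilon>\<^sub>1 \<epsilon>\<^sub>2 = \<Inter> {\<rho>. equiv T \<rho> \<and> \<epsilon>\<^sub>1 \<subseteq> \<rho> \<and> \<epsilon>\<^sub>2 \<subseteq> \<rho>}"

definition pb_join ::
  "'a set \<Rightarrow> ('a \<times> 'a) set \<times> 'a set \<Rightarrow> ('a \<times> 'a) set \<times> 'a set
    \<Rightarrow> ('a \<times> 'a) set \<times> ('a \<times> 'a) set" where
  "pb_join T = (\<lambda>(\<epsilon>\<^sub>1, X\<^sub>1) (\<epsilon>\<^sub>2, X\<^sub>2).
     (equiv_join T \<epsilon>\<^sub>1 \<epsilon>\<^sub>2, {(x, y) \<in> X\<^sub>1 \<times> X\<^sub>2. (x, y) \<in> equiv_join T \<epsilon>\<^sub>1 \<epsilon>\<^sub>2}))"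

definition pb_rank :: "('a \<times> 'a) set \<times> ('a \<times> 'a) set \<Rightarrow> nat" where
  "pb_rank = (\<lambda>(\<epsilon>, Z). card Z)"

definition eps_classes :: "nat \<Rightarrow> nat \<Rightarrow> nat set set" where
  "eps_classes m k = {{i} | i. 1 \<le> i \<and> i \<le> k} \<union> {{k + 2 * j + 1, k + 2 * j + 2} | j. k + 2 * j + 2 \<le> m}"

definition eps_defined :: "nat \<Rightarrow> nat \<Rightarrow> bool" where
  "eps_defined m k \<longleftrightarrow> k \<le> m \<and> k mod 2 = m mod 2"

(* Meaningful only if eps_defined m k. *)
definition eps :: "nat \<Rightarrow> nat \<Rightarrow> (nat \<times> nat) set" where
  "eps m k = {(x, y). \<exists>C \<in> eps_classes m k. x \<in> C \<and> y \<in> C}"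

definition mu :: "nat \<Rightarrow> nat \<Rightarrow> nat \<Rightarrow> nat \<Rightarrow> nat" where
  "mu m k t q =
     (if eps_defined m k \<and> pb_pair {1..m} (eps m k, {1..t})
      then card {(\<eta>, X). pb_pair {1..m} (\<eta>, X) \<and> card X = q \<and>
                   pb_rank (pb_join {1..m} (eps m k, {1..t}) (\<eta>, X)) = q}
      else 0)"

lemma equiv_equiv_join:
  assumes "equiv T \<epsilon>\<^sub>1" "equiv T \<epsilon>\<^sub>2"
  shows "equiv T (equiv_join T \<epsilon>\<^sub>1 \<epsilon>\<^sub>2)"
proof -
  have "equiv T (T \<times> T)"
    by (auto intro!: equivI refl_onI symI transI)
  moreover have "\<epsilon>\<^sub>1 \<subseteq> T \<times> T" "\<epsilon>\<^sub>2 \<subseteq> T \<times> T"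
    using assms by (auto simp: equiv_def)
  ultimately have "equiv_join T \<epsilon>\<^sub>1 \<epsilon>\<^sub>2 \<subseteq> T \<times> T"
    unfolding equiv_join_def by blast
  moreover have "refl_on T (equiv_join T \<epsilon>\<^sub>1 \<epsilon>\<^sub>2)"
    by (auto simp: equiv_join_def equiv_def refl_on_def)
  moreover have "sym (equiv_join T \<epsilon>\<^sub>1 \<epsilon>\<^sub>2)"
    unfolding equiv_join_def by (rule symI) (auto simp: equiv_def dest: symD)
  moreover have "trans (equiv_join T \<epsilon>\<^sub>1 \<epsilon>\<^sub>2)"
    unfolding equiv_join_def trans_def equiv_def by blast
  ultimately show ?thesis unfolding equiv_def by blast
qed

lemma eps_classes_disjoint:
  assumes "C \<in> eps_classes m k" "D \<in> eps_classes m k" "x \<in> C" "x \<in> D"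
  shows "C = D"
proof -
  have aux: "i = j" if "x = k + 2 * i + 1 \<or> x = k + 2 * i + 2" "x = k + 2 * j + 1 \<or> x = k + 2 * j + 2" for i j
    using that by linarith
  have shape: "(x \<le> k \<and> E = {x}) \<or>
      (\<exists>j. (x = k + 2 * j + 1 \<or> x = k + 2 * j + 2) \<and> E = {k + 2 * j + 1, k + 2 * j + 2})"
    if "E \<in> eps_classes m k" "x \<in> E" for E
    using that unfolding eps_classes_def by blast
  from shape[OF assms(1,3)] shape[OF assms(2,4)] show ?thesis
  proof (elim disjE[of "x \<le> k \<and> _"] exE conjE)
    fix i j
    assume "x = k + 2 * i + 1 \<or> x = k + 2 * i + 2" "C = {k + 2 * i + 1, k + 2 * i + 2}"
      "x = k + 2 * j + 1 \<or> x = k + 2 * j + 2" "D = {k + 2 * j + 1, k + 2 * j + 2}"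
    then show ?thesis using aux[of i j] by simp
  qed auto
qed

lemma Union_eps_classes:
  assumes "eps_defined m k"
  shows "\<Union> (eps_classes m k) = {1..m}"
proof (intro equalityI subsetI)
  fix x assume "x \<in> \<Union> (eps_classes m k)"
  then show "x \<in> {1..m}" using assms by (auto simp: eps_classes_def eps_defined_def)
next
  fix x assume x: "x \<in> {1..m}"
  show "x \<in> \<Union> (eps_classes m k)"
  proof (cases "x \<le> k")
    case True
    then show ?thesis using x by (auto simp: eps_classes_def)
  next
    case False
    define j where "j = (x - k - 1) div 2"
    have xj: "x = k + 2 * j + 1 \<or> x = k + 2 * j + 2"
      using False unfolding j_def by presburger
    obtain d where "m = k + 2 * d"
      using assms unfolding eps_defined_def by (metis le_add_diff_inverse mod_eq_dvd_iff_nat dvdE)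
    moreover from this have "k + 2 * j + 2 \<le> m"
      using x xj unfolding atLeastAtMost_iff by arith
    moreover note xj
    ultimately show ?thesis unfolding eps_classes_def by blast
  qed
qed

lemma equiv_eps:
  assumes "eps_defined m k"
  shows "equiv {1..m} (eps m k)"
proof (rule equivI)
  show "eps m k \<subseteq> {1..m} \<times> {1..m}" "refl_on {1..m} (eps m k)"
    unfolding Union_eps_classes[OF assms, symmetric] by (auto simp: eps_def refl_on_def)
  show "sym (eps m k)" by (auto simp: eps_def sym_def)
  show "trans (eps m k)"
  proof (rule transI)
    fix x y z assume "(x, y) \<in> eps m k" "(y, z) \<in> eps m k"
    then obtain C D where "C \<in> eps_classes m k" "x \<in> C" "y \<in> C"
      "D \<in> eps_classes m k" "y \<in> D" "z \<in> D"
      unfolding eps_def by blast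
    moreover from this have "C = D" by (metis eps_classes_disjoint)
    ultimately show "(x, z) \<in> eps m k" unfolding eps_def by blast
  qed
qed

lemma quotient_eps:
  assumes "eps_defined m k"
  shows "{1..m} // eps m k = eps_classes m k"
proof -
  have img: "eps m k `` {x} = C" if "C \<in> eps_classes m k" "x \<in> C" for x C
  proof -
    have "D = C" if "D \<in> eps_classes m k" "x \<in> D" for D
      using eps_classes_disjoint[OF that(1) _ that(2)] \<open>C \<in> _\<close> \<open>x \<in> C\<close> by metis
    then show ?thesis using that unfolding eps_def by blast
  qed
  have ne: "C \<noteq> {}" if "C \<in> eps_classes m k" for C
    using that by (auto simp: eps_classes_def)
  show ?thesis
  proof (intro equalityI subsetI)
    fix C assume "C \<in> {1..m} // eps m k"
    then show "C \<in> eps_classes m k"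
      using img unfolding Union_eps_classes[OF assms, symmetric] by (auto elim!: quotientE)
  next
    fix C assume C: "C \<in> eps_classes m k"
    then obtain x where "x \<in> C" using ne by blast
    then show "C \<in> {1..m} // eps m k"
      using img[OF C \<open>x \<in> C\<close>] C unfolding Union_eps_classes[OF assms, symmetric]
      by (metis UnionI \<open>x \<in> C\<close> quotientI)
  qed
qed

end

theory Submission
  imports Defs
begin

text \<open>
  Passing from \<open>\<epsilon>\<^bsub>n,k+2\<^esub>\<close> to \<open>\<epsilon>\<^bsub>n,k\<^esub>\<close> merges the two singleton classes of \<open>k+1\<close> and
  \<open>k+2\<close>, neither of which lies in \<open>[r]\<close>.  So the relation gets larger and every join gets larger:
  for each PB-pair \<open>(\<eta>, X)\<close>, the rank can only grow.  On the other hand the rank never exceeds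
  \<open>|X|\<close> (\<open>pb_rank_join_le_card\<close>).  Hence each pair of rank \<open>q = |X|\<close> for \<open>k+2\<close> also has rank \<open>q\<close>
  for \<open>k\<close>, and \<open>\<mu>\<close> is the cardinality of a set that can only grow.

  The bound on the rank is the only point with content.  A 1-2-equivalence is a matching, so the
  classes of the join of two of them are the components of a union of two matchings, that is,
  paths and cycles.  A \<open>y\<close> that is unmatched in the second matching is an end of its path; going
  along the path from \<open>y\<close>, the first point that is unmatched in the first matching is the other
  end, so there is at most one such point (\<open>alternating_walk_end_unique\<close>).

  The inequality is strict because of the pair in which \<open>\<eta>\<close> has the single nontrivial class
  \<open>{1, k+2}\<close> and \<open>X = {2, \<dots>, q} \<union> {k+1}\<close>.  With \<open>\<epsilon>\<^bsub>n,k\<^esub>\<close> the path \<open>1, k+2, k+1\<close> links \<open>k+1\<close> to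
  \<open>1 \<in> [r]\<close>, while with \<open>\<epsilon>\<^bsub>n,k+2\<^esub>\<close> the point \<open>k+1\<close> is isolated.
\<close>

section \<open>Components of a union of two matchings\<close>

fun alternating_walk :: "('a \<Rightarrow> 'a) \<Rightarrow> ('a \<Rightarrow> 'a) \<Rightarrow> 'a \<Rightarrow> nat \<Rightarrow> 'a" where
  "alternating_walk a b y 0 = y"
| "alternating_walk a b y (Suc i) = (if even i then a else b) (alternating_walk a b y i)"

text \<open>
  Here \<open>a\<close> and \<open>b\<close> exchange the two points of each edge of two matchings and fix the
  unmatched points; the component of \<open>y\<close> is the least set that contains \<open>y\<close> and is closed under
  both.  Since \<open>b\<close> fixes \<open>y\<close>, the walk covers this component, and the part of the walk up to
  its first \<open>a\<close>-fixed point is already closed, because there the walk turns back.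
\<close>

lemma alternating_walk_end_unique:
  assumes a: "\<And>u. a (a u) = u" and b: "\<And>u. b (b u) = u" and y: "b y = y"
    and comp: "\<And>C. y \<in> C \<Longrightarrow> a ` C \<subseteq> C \<Longrightarrow> b ` C \<subseteq> C \<Longrightarrow> x \<in> C \<and> x' \<in> C"
    and x: "a x = x" and x': "a x' = x'"
  shows "x = x'"
proof -
  define w where "w = alternating_walk a b y"
  have w0: "w 0 = y" by (simp add: w_def)
  have even_a: "a (w i) = w (Suc i)" if "even i" for i using that by (simp add: w_def)
  have odd_b: "b (w i) = w (Suc i)" if "odd i" for i using that by (simp add: w_def)
  have odd_a: "a (w i) = w (i - 1)" if "odd i" for i
  proof (cases i)
    case (Suc j)
    then show ?thesis using even_a[of j] a that by (metis diff_Suc_1 even_Suc)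
  qed (use that in simp)
  have even_b: "b (w i) = w (i - 1)" if "even i" for i
  proof (cases i)
    case (Suc j)
    then show ?thesis using odd_b[of j] b that by (metis diff_Suc_1 even_Suc)
  qed (simp add: w0 y)
  have "y \<in> range w" using w0[symmetric] by simp
  moreover have "a (w i) \<in> range w" for i by (cases "even i") (simp_all add: even_a odd_a)
  then have "a ` range w \<subseteq> range w" by blast
  moreover have "b (w i) \<in> range w" for i by (cases "even i") (simp_all add: even_b odd_b)
  then have "b ` range w \<subseteq> range w" by blast
  ultimately have "x \<in> range w" using comp by blast
  then have ex: "\<exists>i. a (w i) = w i" using x by auto
  define N where "N = (LEAST i. a (w i) = w i)"
  have N: "a (w N) = w N" unfolding N_def using ex by (rule LeastI_ex)
  have minimal: "a (w i) \<noteq> w i" if "i < N" for i using that not_less_Least unfolding N_def by blast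
  \<comment> \<open>At an odd time the walk has just made an \<open>a\<close>-step, so the preceding point would be fixed too.\<close>
  have "even N"
  proof (rule ccontr)
    assume odd: "odd N"
    then have "w (N - 1) = w N" using N odd_a by simp
    then show False using minimal[of "N - 1"] N odd by (simp add: odd_pos)
  qed
  let ?C = "w ` {..N}"
  have "y \<in> ?C" unfolding w0[symmetric] by blast
  moreover have "a (w i) \<in> ?C" if "i \<le> N" for i
  proof (cases "i = N")
    case False
    then show ?thesis using that even_a[of i] odd_a[of i] by (cases "even i") auto
  qed (simp add: N)
  moreover have "b (w i) \<in> ?C" if "i \<le> N" for i
  proof (cases "even i")
    case True
    then show ?thesis using even_b that by simp
  next
    case False
    then have "i \<noteq> N" using \<open>even N\<close> by blast
    then show ?thesis using odd_b False that by simp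
  qed
  ultimately have "x \<in> ?C \<and> x' \<in> ?C" by (intro comp) auto
  then obtain i j where "x = w i" "i \<le> N" "x' = w j" "j \<le> N" by blast
  then have "i = N" "j = N" using minimal[of i] minimal[of j] x x' by fastforce+
  then show ?thesis using \<open>x = w i\<close> \<open>x' = w j\<close> by simp
qed

text \<open>
  The map \<open>a\<close> sends each point to the other point of its class, if there is one.  It turns the
  classes of a 1-2-equivalence into steps of an alternating walk.
\<close>

lemma one_two_equiv_involution:
  assumes "one_two_equiv T \<epsilon>"
  obtains a where "\<And>u. a (a u) = u" and "\<And>u v. (u, v) \<in> \<epsilon> \<Longrightarrow> u \<noteq> v \<Longrightarrow> v = a u"
    and "\<And>u. a u \<noteq> u \<Longrightarrow> (u, a u) \<in> \<epsilon>"
proof -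
  have eq: "equiv T \<epsilon>" and small: "\<And>C. C \<in> T // \<epsilon> \<Longrightarrow> finite C \<and> card C \<le> 2"
    using assms by (auto simp: one_two_equiv_def)
  have sub: "\<epsilon> \<subseteq> T \<times> T" using eq by (auto simp: equiv_def)
  have sym: "(v, u) \<in> \<epsilon>" if "(u, v) \<in> \<epsilon>" for u v using eq that by (auto simp: equiv_def dest: symD)
  have unique: "v = v'" if "(u, v) \<in> \<epsilon>" "u \<noteq> v" "(u, v') \<in> \<epsilon>" "u \<noteq> v'" for u v v'
  proof (rule ccontr)
    assume "v \<noteq> v'"
    have "u \<in> T" using that sub by auto
    then have "{u, v, v'} \<subseteq> \<epsilon> `` {u}" "finite (\<epsilon> `` {u})" "card (\<epsilon> `` {u}) \<le> 2"
      using that small[OF quotientI[of u T \<epsilon>]] equiv_class_self[OF eq, of u] by auto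
    then have "card {u, v, v'} \<le> 2" by (meson card_mono le_trans)
    then show False using that \<open>v \<noteq> v'\<close> by simp
  qed
  define a where "a u = (if \<exists>v. (u, v) \<in> \<epsilon> \<and> u \<noteq> v then SOME v. (u, v) \<in> \<epsilon> \<and> u \<noteq> v else u)" for u
  have a_edge: "(u, a u) \<in> \<epsilon>" if "a u \<noteq> u" for u
  proof -
    have "\<exists>v. (u, v) \<in> \<epsilon> \<and> u \<noteq> v" using that unfolding a_def by metis
    from someI_ex[OF this] this show ?thesis unfolding a_def by simp
  qed
  have a_eq: "v = a u" if "(u, v) \<in> \<epsilon>" "u \<noteq> v" for u v
  proof -
    have ex: "\<exists>v. (u, v) \<in> \<epsilon> \<and> u \<noteq> v" using that by blast
    from someI_ex[OF this] ex have "(u, a u) \<in> \<epsilon> \<and> u \<noteq> a u" unfolding a_def by simp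
    then show ?thesis using unique that by blast
  qed
  have "a (a u) = u" for u
    using a_edge a_eq sym by metis
  then show thesis using that a_edge a_eq by blast
qed

section \<open>The rank of a join of PB-pairs\<close>

text \<open>
  A set that no edge of either relation leaves yields an equivalence with two classes above both
  relations, so the join cannot leave the set either.
\<close>

lemma equiv_join_closed:
  assumes "equiv T \<epsilon>" "equiv T \<eta>"
    and "(\<epsilon> \<union> \<eta>) `` C \<subseteq> C"
    and "(u, v) \<in> equiv_join T \<epsilon> \<eta>" "u \<in> C"
  shows "v \<in> C"
proof -
  let ?\<rho> = "{(u, v). u \<in> T \<and> v \<in> T \<and> (u \<in> C \<longleftrightarrow> v \<in> C)}"
  have "equiv T ?\<rho>" by (auto intro!: equivI refl_onI symI transI)
  moreover have "\<epsilon> \<subseteq> ?\<rho>" "\<eta> \<subseteq> ?\<rho>"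
    using assms(1-3) unfolding equiv_def sym_def by blast+
  ultimately have "(u, v) \<in> ?\<rho>" using assms(4) unfolding equiv_join_def by blast
  then show ?thesis using assms(5) by simp
qed

lemma pb_rank_pb_join:
  "pb_rank (pb_join T (\<epsilon>, X) (\<eta>, Y)) = card {(x, y) \<in> X \<times> Y. (x, y) \<in> equiv_join T \<epsilon> \<eta>}"
  by (simp add: pb_rank_def pb_join_def)

lemma pb_pair_fixed:
  assumes "pb_pair T (\<epsilon>, X)" "x \<in> X" "(x, v) \<in> \<epsilon>"
  shows "v = x"
proof -
  have "equiv T \<epsilon>" "{x} \<in> T // \<epsilon>" using assms by (auto simp: pb_pair_def one_two_equiv_def)
  then have "\<epsilon> `` {x} = {x}" by (metis Image_singleton_iff equiv_class_eq quotientE singletonI)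
  then show ?thesis using assms(3) by blast
qed

text \<open>
  Both elements of \<open>X\<close> are unmatched in \<open>\<epsilon>\<close> and \<open>y\<close> is unmatched in \<open>\<eta>\<close>, so the walk that starts
  at \<open>y\<close> can end in only one of them.
\<close>

lemma pb_join_partner_unique:
  assumes \<epsilon>: "pb_pair T (\<epsilon>, X)" and \<eta>: "pb_pair T (\<eta>, Y)"
    and "x \<in> X" "x' \<in> X" "y \<in> Y"
    and "(x, y) \<in> equiv_join T \<epsilon> \<eta>" "(x', y) \<in> equiv_join T \<epsilon> \<eta>"
  shows "x = x'"
proof -
  have eqs: "one_two_equiv T \<epsilon>" "one_two_equiv T \<eta>" "equiv T \<epsilon>" "equiv T \<eta>"
    using \<epsilon> \<eta> by (auto simp: pb_pair_def one_two_equiv_def)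
  obtain a where a: "\<And>u. a (a u) = u" "\<And>u v. (u, v) \<in> \<epsilon> \<Longrightarrow> u \<noteq> v \<Longrightarrow> v = a u"
    "\<And>u. a u \<noteq> u \<Longrightarrow> (u, a u) \<in> \<epsilon>" using one_two_equiv_involution[OF eqs(1)] by blast
  obtain b where b: "\<And>u. b (b u) = u" "\<And>u v. (u, v) \<in> \<eta> \<Longrightarrow> u \<noteq> v \<Longrightarrow> v = b u"
    "\<And>u. b u \<noteq> u \<Longrightarrow> (u, b u) \<in> \<eta>" using one_two_equiv_involution[OF eqs(2)] by blast
  have joins: "(y, x) \<in> equiv_join T \<epsilon> \<eta>" "(y, x') \<in> equiv_join T \<epsilon> \<eta>"
    using assms(6,7) equiv_equiv_join[OF eqs(3,4)] by (auto simp: equiv_def dest: symD)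
  show ?thesis
  proof (rule alternating_walk_end_unique[of a b y, OF a(1) b(1)])
    show "b y = y" using b(3) pb_pair_fixed[OF \<eta> \<open>y \<in> Y\<close>] by blast
    show "a x = x" "a x' = x'" using a(3) pb_pair_fixed[OF \<epsilon>] \<open>x \<in> X\<close> \<open>x' \<in> X\<close> by blast+
  next
    fix C assume C: "y \<in> C" "a ` C \<subseteq> C" "b ` C \<subseteq> C"
    have "v \<in> C" if "(u, v) \<in> \<epsilon> \<union> \<eta>" "u \<in> C" for u v
      using that a(2)[of u v] b(2)[of u v] C by (cases "u = v") auto
    then have "(\<epsilon> \<union> \<eta>) `` C \<subseteq> C" by blast
    from equiv_join_closed[OF eqs(3,4) this _ C(1)] joins show "x \<in> C \<and> x' \<in> C" by blast
  qed
qed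

lemma pb_rank_join_le_card:
  assumes "pb_pair T (\<epsilon>, X)" "pb_pair T (\<eta>, Y)" "finite Y"
  shows "pb_rank (pb_join T (\<epsilon>, X) (\<eta>, Y)) \<le> card Y"
  unfolding pb_rank_pb_join
proof (rule card_inj_on_le[where f = snd])
  show "inj_on snd {(x, y) \<in> X \<times> Y. (x, y) \<in> equiv_join T \<epsilon> \<eta>}"
    by (rule inj_onI) (auto intro: pb_join_partner_unique[OF assms(1,2)])
qed (use assms in auto)

section \<open>The equivalences \<open>\<epsilon>\<^bsub>m,k\<^esub>\<close>\<close>

lemma pb_pair_eps:
  assumes "eps_defined m k" "t \<le> k"
  shows "pb_pair {1..m} (eps m k, {1..t})"
proof -
  have "finite C \<and> card C \<le> 2" if "C \<in> eps_classes m k" for C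
    using that by (auto simp: eps_classes_def card_insert_if)
  then have "one_two_equiv {1..m} (eps m k)"
    using assms equiv_eps quotient_eps by (simp add: one_two_equiv_def)
  moreover have "{x} \<in> {1..m} // eps m k" if "x \<in> {1..t}" for x
    unfolding quotient_eps[OF assms(1)] using that assms by (auto simp: eps_classes_def)
  ultimately show ?thesis using assms by (auto simp: pb_pair_def eps_defined_def)
qed

lemma eps_classes_pairI:
  assumes "k + 2 * j + 2 \<le> m"
  shows "{k + 2 * j + 1, k + 2 * j + 2} \<in> eps_classes m k"
  unfolding eps_classes_def using assms by blast

lemma eps_antimono:
  assumes "k + 2 \<le> m"
  shows "eps m (k + 2) \<subseteq> eps m k"
proof -
  have refines: "\<exists>D \<in> eps_classes m k. C \<subseteq> D" if "C \<in> eps_classes m (k + 2)" for C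
  proof -
    from that consider i where "C = {i}" "1 \<le> i" "i \<le> k" | i where "C = {i}" "k < i" "i \<le> k + 2"
      | j where "C = {k + 2 + 2 * j + 1, k + 2 + 2 * j + 2}" "k + 2 + 2 * j + 2 \<le> m"
      unfolding eps_classes_def by fastforce
    then show ?thesis
    proof cases
      case (1 i)
      then show ?thesis by (auto simp: eps_classes_def)
    next
      case (2 i)
      then have "C \<subseteq> {k + 2 * 0 + 1, k + 2 * 0 + 2}" by auto
      then show ?thesis using eps_classes_pairI[of k 0 m] assms by auto
    next
      case (3 j)
      then have "C \<subseteq> {k + 2 * Suc j + 1, k + 2 * Suc j + 2}" by auto
      moreover have "k + 2 * Suc j + 2 \<le> m" using 3 by simp
      ultimately show ?thesis using eps_classes_pairI by blast
    qed
  qed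
  show ?thesis
  proof (rule subrelI)
    fix x y assume "(x, y) \<in> eps m (k + 2)"
    then obtain C where "C \<in> eps_classes m (k + 2)" "x \<in> C" "y \<in> C" unfolding eps_def by auto
    then show "(x, y) \<in> eps m k" using refines[of C] unfolding eps_def by auto
  qed
qed

section \<open>The strict inequality\<close>

lemma equiv_join_mono:
  assumes "\<epsilon> \<subseteq> \<epsilon>'"
  shows "equiv_join T \<epsilon> \<eta> \<subseteq> equiv_join T \<epsilon>' \<eta>"
  using assms unfolding equiv_join_def by blast

lemma equiv_join_upper: "\<epsilon> \<union> \<eta> \<subseteq> equiv_join T \<epsilon> \<eta>"
  unfolding equiv_join_def by blast

lemma pb_pair_single_edge:
  assumes "u \<in> T" "v \<in> T" "u \<noteq> v" "X \<subseteq> T - {u, v}"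
  shows "pb_pair T (Id_on T \<union> {(u, v), (v, u)}, X)"
proof -
  let ?\<eta> = "Id_on T \<union> {(u, v), (v, u)}"
  have cls: "?\<eta> `` {x} = (if x \<in> {u, v} then {u, v} else {x})" if "x \<in> T" for x
    using that assms by auto
  have "equiv T ?\<eta>"
    using assms by (auto intro!: equivI refl_onI symI transI)
  moreover have "finite C \<and> card C \<le> 2" if "C \<in> T // ?\<eta>" for C
  proof -
    from that obtain x where "x \<in> T" "C = ?\<eta> `` {x}" by (rule quotientE)
    then have "C = (if x \<in> {u, v} then {u, v} else {x})" using cls by simp
    then show ?thesis by (simp add: card_insert_if)
  qed
  moreover have "{x} \<in> T // ?\<eta>" if "x \<in> X" for x
  proof -
    have "x \<in> T" "x \<notin> {u, v}" using that assms by auto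
    then show ?thesis using cls[of x] quotientI[of x T ?\<eta>] by simp
  qed
  ultimately show ?thesis using assms unfolding pb_pair_def one_two_equiv_def by blast
qed

theorem lemma4p4:
  fixes n k r q :: nat
  assumes "n \<ge> k" and "k \<ge> r" and "r \<ge> q" and "q \<ge> 1"
    and "n mod 2 = k mod 2"
    and "n \<ge> k + 2"
  shows "mu n k r q > mu n (k + 2) r q"
proof -
  let ?T = "{1..n}"
  define rank where "rank l \<eta> X = pb_rank (pb_join ?T (eps n l, {1..r}) (\<eta>, X))"
    for l and \<eta> :: "(nat \<times> nat) set" and X :: "nat set"
  define M where "M l = {(\<eta>, X). pb_pair ?T (\<eta>, X) \<and> card X = q \<and> rank l \<eta> X = q}" for l
  have defined: "eps_defined n k" "eps_defined n (k + 2)"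
    using assms by (auto simp: eps_defined_def)
  have pairs: "pb_pair ?T (eps n k, {1..r})" "pb_pair ?T (eps n (k + 2), {1..r})"
    using pb_pair_eps defined assms by simp_all
  have mu: "mu n k r q = card (M k)" "mu n (k + 2) r q = card (M (k + 2))"
    using defined pairs by (simp_all add: mu_def M_def rank_def)
  have fin: "finite X" if "pb_pair ?T (\<eta>, X)" for \<eta> X
    using that by (auto simp: pb_pair_def intro: finite_subset)
  have rank_le: "rank k \<eta> X \<le> card X" "rank (k + 2) \<eta> X \<le> card X" if "pb_pair ?T (\<eta>, X)" for \<eta> X
    unfolding rank_def using pb_rank_join_le_card pairs that fin by blast+
  have rank_mono: "rank (k + 2) \<eta> X \<le> rank k \<eta> X" if "pb_pair ?T (\<eta>, X)" for \<eta> X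
    unfolding rank_def pb_rank_pb_join
  proof (rule card_mono)
    show "finite {(x, y) \<in> {1..r} \<times> X. (x, y) \<in> equiv_join ?T (eps n k) \<eta>}"
      by (rule finite_subset[of _ "{1..r} \<times> X"]) (use fin[OF that] in auto)
  qed (use equiv_join_mono[OF eps_antimono] assms in blast)
  have "M (k + 2) \<subseteq> M k"
    unfolding M_def using rank_mono rank_le(1) by (fastforce intro: antisym)
  moreover have "\<exists>p. p \<in> M k \<and> p \<notin> M (k + 2)"
  proof -
    define \<eta> where "\<eta> = Id_on ?T \<union> {(1, k + 2), (k + 2, 1)}"
    define X where "X = insert (k + 1) {2..q}"
    have card_X: "card X = q" using assms by (simp add: X_def)
    have pX: "pb_pair ?T (\<eta>, X)" and p2: "pb_pair ?T (\<eta>, {2..q})"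
      unfolding \<eta>_def X_def by (rule pb_pair_single_edge; use assms in auto)+
    have equivs: "equiv ?T (eps n k)" "equiv ?T (eps n (k + 2))" "equiv ?T \<eta>"
      using equiv_eps defined pX by (auto simp: pb_pair_def one_two_equiv_def)
    let ?J = "equiv_join ?T (eps n k) \<eta>"
    have "{k + 2 * 0 + 1, k + 2 * 0 + 2} \<in> eps_classes n k"
      using assms by (intro eps_classes_pairI) simp
    then have "(k + 2, k + 1) \<in> eps n k" unfolding eps_def by auto
    moreover have "(1, k + 2) \<in> \<eta>" by (simp add: \<eta>_def)
    ultimately have "(k + 2, k + 1) \<in> ?J" "(1, k + 2) \<in> ?J"
      using equiv_join_upper[of "eps n k" \<eta> ?T] by blast+
    then have linked: "(1, k + 1) \<in> ?J"
      using equiv_equiv_join[OF equivs(1,3)] unfolding equiv_def trans_def by blast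
    have diag: "(i, i) \<in> ?J" if "i \<in> {2..q}" for i
      by (rule equiv_class_eq_iff[THEN iffD2, OF equiv_equiv_join[OF equivs(1,3)]])
        (use that assms in simp)
    let ?Z = "insert (1, k + 1) ((\<lambda>i. (i, i)) ` {2..q})"
    have "card ?Z = q"
    proof -
      have "card ((\<lambda>i. (i, i)) ` {2..q}) = q - 1" by (subst card_image) (auto simp: inj_on_def)
      moreover have "(1, k + 1) \<notin> (\<lambda>i. (i, i)) ` {2..q}" using assms by auto
      ultimately show ?thesis using assms by simp
    qed
    moreover have "card ?Z \<le> rank k \<eta> X"
      unfolding rank_def pb_rank_pb_join
    proof (rule card_mono)
      show "finite {(x, y) \<in> {1..r} \<times> X. (x, y) \<in> ?J}"
        by (rule finite_subset[of _ "{1..r} \<times> X"]) (use fin[OF pX] in auto)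
      show "?Z \<subseteq> {(x, y) \<in> {1..r} \<times> X. (x, y) \<in> ?J}"
        using linked diag assms by (auto simp: X_def)
    qed
    ultimately have "rank k \<eta> X = q" using rank_le(1)[OF pX] card_X by simp
    then have "(\<eta>, X) \<in> M k" unfolding M_def using pX card_X by simp
    \<comment> \<open>The set \<open>- {k + 1}\<close> contains \<open>[r]\<close> and is closed under \<open>\<epsilon>\<^bsub>n,k+2\<^esub>\<close> and \<open>\<eta>\<close>, so \<open>k + 1\<close>
      contributes nothing to the rank and may be dropped from \<open>X\<close>.\<close>
    moreover have "rank (k + 2) \<eta> X < q"
    proof -
      have "(eps n (k + 2) \<union> \<eta>) `` (- {k + 1}) \<subseteq> - {k + 1}"
        using assms by (auto simp: eps_def eps_classes_def \<eta>_def)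
      from equiv_join_closed[OF equivs(2,3) this]
      have "(x, k + 1) \<notin> equiv_join ?T (eps n (k + 2)) \<eta>" if "x \<in> {1..r}" for x
        using that assms by fastforce
      then have "rank (k + 2) \<eta> X = rank (k + 2) \<eta> {2..q}"
        unfolding rank_def pb_rank_pb_join X_def by (intro arg_cong[where f = card]) auto
      then show ?thesis using rank_le(2)[OF p2] assms by simp
    qed
    then have "(\<eta>, X) \<notin> M (k + 2)" unfolding M_def by simp
    ultimately show ?thesis by blast
  qed
  ultimately have "M (k + 2) \<subset> M k" by blast
  moreover have "finite (M k)"
  proof (rule finite_subset)
    show "M k \<subseteq> Pow (?T \<times> ?T) \<times> Pow ?T"
      by (auto simp: M_def pb_pair_def one_two_equiv_def equiv_def dest: subsetD)
  qed simp
  ultimately show ?thesis unfolding mu by (intro psubset_card_mono)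
qed

end
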